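(* Let $m \ge 3$ and $n \ge 1$, and let $T_{m,n}$ be the tadpole graph obtained from the disjoint union of a cycle $C_m$ and a path $P_n$ by joining a vertex of $C_m$ with an end-vertex of $P_n$ by an edge. Then $\gamma_g(T_{m,n}) \le \left\lceil \frac{m+n}{2}\right\rceil$.
   Context: The domination game on a graph $G$ is played by Dominator and Staller, who alternately select vertices of $G$; each selected vertex must dominate (i.e., be equal or adjacent to) at least one vertex not dominated by the previously selected vertices. The game ends when no such move is possible. Dominator wants to minimize the number of moves, Staller to maximize it. $\gamma_g(G)$ is the number of moves when both play optimally and Dominator makes the first move. *)

theory Defs
  imports Complex_Main "Graph_Theory.Pair_Digraph"
begin

text \<open>
  Finite simple graphs are symmetric, loop-free pair digraphs (\<^locale>\<open>pair_graph\<close>): an edge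
  joining u and v is the pair of arcs (u, v), (v, u).
\<close>

section \<open>The domination game\<close>

definition closed_nbhd :: "'a pair_pre_digraph \<Rightarrow> 'a \<Rightarrow> 'a set" where
  "closed_nbhd G v = {u \<in> pverts G. u = v \<or> (v, u) \<in> parcs G}"

definition dominated :: "'a pair_pre_digraph \<Rightarrow> 'a set \<Rightarrow> 'a set" where
  "dominated G S = (\<Union>v\<in>S. closed_nbhd G v)"

definition legal_moves :: "'a pair_pre_digraph \<Rightarrow> 'a set \<Rightarrow> 'a set" where
  "legal_moves G S = {v \<in> pverts G. \<not> closed_nbhd G v \<subseteq> dominated G S}"

datatype player = Dominator | Staller

fun opponent :: "player \<Rightarrow> player" where
  "opponent Dominator = Staller"
| "opponent Staller = Dominator"

text \<open>Dominator minimizes, Staller maximizes the number of moves.\<close>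

fun best :: "player \<Rightarrow> nat set \<Rightarrow> nat" where
  "best Dominator = Min"
| "best Staller = Max"

text \<open>
  \<open>moves_left G p S\<close> is the number of moves still to be made under optimal play when \<open>S\<close> is the
  set of vertices selected so far and player \<open>p\<close> is to move (backward induction). The value for
  an infinite vertex set is a dummy that only serves termination.
\<close>

function moves_left :: "'a pair_pre_digraph \<Rightarrow> player \<Rightarrow> 'a set \<Rightarrow> nat" where
  "moves_left G p S =
     (if infinite (pverts G) \<or> legal_moves G S = {} then 0
      else Suc (best p ((\<lambda>v. moves_left G (opponent p) (insert v S)) ` legal_moves G S)))"
  by pat_completeness auto
termination
proof (relation "measure (\<lambda>(G, p, S). card (pverts G - dominated G S))", simp, clarsimp)
  fix G :: "'a pair_pre_digraph" and S v
  assume fin: "finite (pverts G)" and v: "v \<in> legal_moves G S"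
  then have "pverts G - dominated G (insert v S) \<subset> pverts G - dominated G S"
    by (auto simp: legal_moves_def dominated_def closed_nbhd_def)
  with fin show "card (pverts G - dominated G (insert v S)) < card (pverts G - dominated G S)"
    by (simp add: psubset_card_mono)
qed

declare moves_left.simps [simp del]

definition game_domination_number :: "'a pair_pre_digraph \<Rightarrow> nat" (\<open>\<gamma>\<^sub>g\<close>) where
  "\<gamma>\<^sub>g G = moves_left G Dominator {}"

section \<open>Tadpole graphs\<close>

definition cycle_graph :: "nat \<Rightarrow> nat pair_pre_digraph" where
  "cycle_graph m = \<lparr>pverts = {..<m},
     parcs = {(i, j). i < m \<and> j < m \<and> (j = Suc i mod m \<or> i = Suc j mod m)}\<rparr>"

definition path_graph :: "nat \<Rightarrow> nat pair_pre_digraph" where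
  "path_graph n = \<lparr>pverts = {..<n},
     parcs = {(i, j). i < n \<and> j < n \<and> (j = Suc i \<or> i = Suc j)}\<rparr>"

definition path_ends :: "nat \<Rightarrow> nat set" where
  "path_ends n = {0, n - 1}"

definition disjoint_union ::
  "'a pair_pre_digraph \<Rightarrow> 'b pair_pre_digraph \<Rightarrow> ('a + 'b) pair_pre_digraph" where
  "disjoint_union G H = \<lparr>pverts = pverts G <+> pverts H,
     parcs = map_prod Inl Inl ` parcs G \<union> map_prod Inr Inr ` parcs H\<rparr>"

definition add_edge :: "'a \<Rightarrow> 'a \<Rightarrow> 'a pair_pre_digraph \<Rightarrow> 'a pair_pre_digraph" where
  "add_edge u v G = \<lparr>pverts = pverts G, parcs = parcs G \<union> {(u, v), (v, u)}\<rparr>"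

text \<open>
  \<open>c\<close> is the vertex of the cycle and \<open>e\<close> the end-vertex of the path that are joined; all choices
  give isomorphic graphs.
\<close>

definition tadpole :: "nat \<Rightarrow> nat \<Rightarrow> nat \<Rightarrow> nat \<Rightarrow> (nat + nat) pair_pre_digraph" where
  "tadpole m n c e = add_edge (Inl c) (Inr e) (disjoint_union (cycle_graph m) (path_graph n))"

lemma pair_graph_tadpole:
  assumes "m \<ge> 3" "n \<ge> 1" "c \<in> pverts (cycle_graph m)" "e \<in> path_ends n"
  shows "pair_graph (tadpole m n c e)"
proof -
  let ?T = "tadpole m n c e"
  have sub: "parcs ?T \<subseteq> pverts ?T \<times> pverts ?T" and fin: "finite (pverts ?T)"
    using assms
    by (auto simp: tadpole_def add_edge_def disjoint_union_def cycle_graph_def path_graph_def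
        path_ends_def)
  have "\<And>i. i < m \<Longrightarrow> i \<noteq> Suc i mod m"
    using assms(1) by (simp add: mod_Suc)
  then have "\<And>x. (x, x) \<notin> parcs ?T"
    by (auto simp: tadpole_def add_edge_def disjoint_union_def cycle_graph_def path_graph_def)
  moreover have "sym (parcs ?T)"
    by (auto simp: sym_def tadpole_def add_edge_def disjoint_union_def cycle_graph_def
        path_graph_def map_prod_def image_iff)
  moreover have "finite (parcs ?T)"
    using sub fin by (meson finite_SigmaI finite_subset)
  ultimately show ?thesis
    using sub fin by unfold_locales (auto simp: symmetric_def)
qed

end

theory Submission
  imports Defs
begin

text \<open>
  Dominator first selects the vertex of degree three. The vertices that remain undominated then lie
  on a line, and every move deletes at most three consecutive ones. The undominated set falls into
  maximal runs of consecutive labels. A run of length \<open>4 q + r\<close> gets weight \<open>4 q + w\<close>, where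
  \<open>w = 0, 2, 3, 4\<close> for \<open>r = 0, 1, 2, 3\<close>, and \<open>W\<close> denotes the total weight.

  Any move of Staller lowers \<open>W\<close> by at least 1, or leaves a run of length 3 modulo 4 without
  raising \<open>W\<close>. Dominator can lower \<open>W\<close> by 4 if there is a run of length 3 modulo 4, by 3 if there
  is one of length 2 modulo 4, and by 2 otherwise, in which case \<open>W\<close> is even. Hence Staller to move faces at
  most \<open>\<lceil>W / 2\<rceil>\<close> more moves. As a run of length \<open>k\<close> weighs at most \<open>k + 1\<close>, the two initial runs,
  with \<open>m + n - 4\<close> vertices in total, weigh at most \<open>m + n - 2\<close>.
\<close>

section \<open>Weights of sets of integers\<close>

definition run_weight :: "nat \<Rightarrow> nat" where
  "run_weight k = 4 * (k div 4) + (if k mod 4 = 0 then 0 else k mod 4 + 1)"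

text \<open>For i in \<open>U\<close>, this is the position of i, counted from 1, in its maximal
  run.\<close>

fun run_position :: "nat set \<Rightarrow> nat \<Rightarrow> nat" where
  "run_position U 0 = (if 0 \<in> U then 1 else 0)"
| "run_position U (Suc i) = (if Suc i \<in> U then Suc (run_position U i) else 0)"

text \<open>Along a run of length k the increments telescope to \<open>run_weight k\<close>, so the
  total weight needs no explicit list of runs. As \<open>run_weight\<close> is monotone, the
  subtraction never truncates.\<close>

definition weight :: "nat set \<Rightarrow> nat" where
  "weight U = (\<Sum>i\<in>U. run_weight (run_position U i) - run_weight (run_position U i - 1))"

definition separated :: "nat set \<Rightarrow> nat set \<Rightarrow> bool" where
  "separated A B \<longleftrightarrow> (\<forall>a\<in>A. \<forall>b\<in>B. Suc a < b \<or> Suc b < a)"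

definition is_run :: "nat set \<Rightarrow> nat \<Rightarrow> nat \<Rightarrow> bool" where
  "is_run U s k \<longleftrightarrow> 0 < s \<and> 0 < k \<and> {s..<s + k} \<subseteq> U \<and> s - 1 \<notin> U \<and> s + k \<notin> U"

text \<open>This invariant keeps a move at a missing label i from deleting i - 1 and i + 1 from two
  different runs.\<close>

definition no_single_gap :: "nat set \<Rightarrow> bool" where
  "no_single_gap U \<longleftrightarrow> (\<forall>i. i \<in> U \<and> i + 2 \<in> U \<longrightarrow> i + 1 \<in> U)"

abbreviation near :: "nat \<Rightarrow> nat set" where
  "near i \<equiv> {i - 1..i + 1}"

section \<open>Arithmetic of the weight of one run\<close>

lemma run_weight_0 [simp]: "run_weight 0 = 0"
  by (simp add: run_weight_def)

lemma run_weight_le: "run_weight k \<le> k + 1"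
  unfolding run_weight_def by presburger

lemma run_weight_Suc_ge: "run_weight k \<le> run_weight (Suc k)"
  unfolding run_weight_def by presburger

lemma run_weight_shift: "run_weight (4 * q + r) = 4 * q + run_weight r"
  by (simp add: run_weight_def)

lemma run_weight_values [simp]:
  "run_weight (Suc 0) = 2" "run_weight 2 = 3" "run_weight 3 = 4" "run_weight 4 = 4"
  "run_weight (4 * q) = 4 * q" "run_weight (Suc (4 * q)) = 4 * q + 2"
  "run_weight (Suc (Suc (4 * q))) = 4 * q + 3"
  using run_weight_shift[of q 2] by (simp_all add: run_weight_def)

lemma mod_4_cases:
  fixes k :: nat
  assumes "0 < k"
  obtains q where "k = 4 * q + 1" | q where "k = 4 * q + 2" | q where "k = 4 * q + 3"
    | q where "k = 4 * q + 4"
proof -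
  define q r where "q = (k - 1) div 4" and "r = (k - 1) mod 4"
  then have "k = 4 * q + r + 1" "r < 4"
    using assms by simp_all
  then have "k = 4 * q + 1 \<or> k = 4 * q + 2 \<or> k = 4 * q + 3 \<or> k = 4 * q + 4"
    by linarith
  then show thesis
    using that by blast
qed

text \<open>The weights of 0, 1, 2, ... are 0, 2, 3, 4, 4, 6, 7, 8, 8, ...; the only step without
  increase goes from 4 q + 3 to 4 q + 4.\<close>

lemma run_weight_minus_1:
  assumes "0 < k"
  shows "run_weight (k - 1) + 1 \<le> run_weight k \<or>
    run_weight (k - 1) \<le> run_weight k \<and> (k - 1) mod 4 = 3"
  using assms
proof (cases k rule: mod_4_cases)
  case (1 q)
  then show ?thesis by (simp add: run_weight_shift)
next
  case (2 q)
  then have "k - 1 = 4 * q + 1" by simp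
  then show ?thesis using 2 by (simp only: run_weight_shift) simp
next
  case (3 q)
  then have "k - 1 = 4 * q + 2" by simp
  then show ?thesis using 3 by (simp only: run_weight_shift) simp
next
  case (4 q)
  then have "k - 1 = 4 * q + 3" by simp
  then show ?thesis using 4 by (simp only: run_weight_shift) simp
qed

lemma run_weight_minus_2:
  assumes "0 < k"
  shows "run_weight (k - 2) + 1 \<le> run_weight k"
  using assms
proof (cases k rule: mod_4_cases)
  case (1 q)
  then have "run_weight (k - 2) \<le> 4 * q"
    using run_weight_le[of "k - 2"] by (cases "q = 0") auto
  then show ?thesis using 1 by (simp add: run_weight_shift)
next
  case (2 q)
  then show ?thesis by (simp add: run_weight_shift)
next
  case (3 q)
  then have "k - 2 = 4 * q + 1" by simp
  then show ?thesis using 3 by (simp only: run_weight_shift) simp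
next
  case (4 q)
  then have "k - 2 = 4 * q + 2" by simp
  then show ?thesis using 4 by (simp only: run_weight_shift) simp
qed

text \<open>For lengths divisible by 4, cutting one or two labels lowers the weight by only 0 or 1.
  Cutting three leaves length 1 modulo 4 and gains 2.\<close>

lemma run_weight_minus_3:
  assumes "k mod 4 = 0" "0 < k"
  shows "run_weight k = run_weight (k - 3) + 2" "3 \<le> k"
proof -
  obtain q where "k = 4 * q"
    using assms(1) by auto
  then obtain p where p: "k = 4 * p + 4"
    using assms(2) by (cases q) auto
  then have "k - 3 = 4 * p + 1"
    by simp
  then show "run_weight k = run_weight (k - 3) + 2" "3 \<le> k"
    using p by (simp_all only: run_weight_shift) simp_all
qed

lemma run_weight_minus_mod_4: "run_weight k = run_weight (k - k mod 4) + run_weight (k mod 4)"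
  using run_weight_shift[of "k div 4" "k mod 4"] by (simp add: minus_mod_eq_mult_div)

text \<open>This covers a move inside a run, which deletes three labels and leaves pieces of lengths
  a and b. Multiples of 4 shift out, and sixteen pairs of residues remain to be checked.\<close>

lemma run_weight_split: "run_weight a + run_weight b + 1 \<le> run_weight (a + b + 3)"
proof -
  define p r q s where "p = a div 4" and "r = a mod 4" and "q = b div 4" and "s = b mod 4"
  then have a: "a = 4 * p + r" "r < 4" and b: "b = 4 * q + s" "s < 4"
    by simp_all
  then have "r \<in> {0, 1, 2, 3}" "s \<in> {0, 1, 2, 3}"
    by auto
  then have "run_weight r + run_weight s + 1 \<le> run_weight (r + s + 3)"
    by (auto simp: run_weight_def)
  moreover have "a + b + 3 = 4 * (p + q) + (r + s + 3)"
    by (simp add: a b)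
  ultimately show ?thesis
    using a(1) b(1) by (simp only: run_weight_shift)
qed

section \<open>Additivity of the weight over separated sets\<close>

lemma run_position_Un:
  assumes "separated A B" "i \<in> A"
  shows "run_position (A \<union> B) i = run_position A i"
  using assms(2)
proof (induction i)
  case (Suc i)
  \<comment> \<open>The predecessor of an element of \<open>A\<close> is never in \<open>B\<close>,
    so the recursion stops before it could reach \<open>B\<close>.\<close>
  have "i \<notin> B"
    using assms(1) Suc.prems unfolding separated_def by (metis Suc_lessD less_irrefl lessI)
  then have "i \<notin> A \<Longrightarrow> run_position (A \<union> B) i = 0 \<and> run_position A i = 0"
    by (cases i) auto
  then have "run_position (A \<union> B) i = run_position A i"
    using Suc.IH by (cases "i \<in> A") auto
  then show ?case
    using Suc.prems by simp
qed auto

lemma separated_sym: "separated A B \<longleftrightarrow> separated B A"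
  by (auto simp: separated_def)

lemma weight_Un:
  assumes "separated A B" "finite A" "finite B"
  shows "weight (A \<union> B) = weight A + weight B"
proof -
  have "A \<inter> B = {}"
    using assms(1) by (fastforce simp: separated_def)
  then show ?thesis
    using assms run_position_Un[of A B] run_position_Un[of B A]
    by (simp add: weight_def sum.union_disjoint separated_sym[of B A] Un_commute[of B A])
qed

lemma run_position_interval:
  "j < k \<Longrightarrow> 0 < s \<Longrightarrow> run_position {s..<s + k} (s + j) = Suc j"
proof (induction j)
  case 0
  then show ?case by (cases s; cases "s - 1") auto
qed auto

lemma weight_interval:
  assumes "0 < s"
  shows "weight {s..<s + k} = run_weight k"
proof -
  have "weight {s..<s + k} = (\<Sum>i\<in>{s..<s + k}. run_weight (Suc (i - s)) - run_weight (i - s))"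
    unfolding weight_def
  proof (rule sum.cong)
    fix i
    assume "i \<in> {s..<s + k}"
    then have "run_position {s..<s + k} i = Suc (i - s)"
      using run_position_interval[of "i - s" k s] assms by auto
    then show "run_weight (run_position {s..<s + k} i) - run_weight (run_position {s..<s + k} i - 1) =
        run_weight (Suc (i - s)) - run_weight (i - s)"
      by simp
  qed simp
  also have "\<dots> = (\<Sum>j<k. run_weight (Suc j) - run_weight j)"
    by (rule sum.reindex_bij_witness[of _ "\<lambda>j. s + j" "\<lambda>i. i - s"]) auto
  also have "\<dots> = run_weight k"
    by (induction k) (auto simp: run_weight_Suc_ge)
  finally show ?thesis .
qed

section \<open>Maximal runs\<close>

lemma is_run_exists:
  assumes "finite U" "x \<in> U" "0 \<notin> U"
  obtains s k where "is_run U s k" "x \<in> {s..<s + k}"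
proof -
  \<comment> \<open>The run of x lies between the nearest missing labels: one exists below since 0
    is missing, and one above since \<open>U\<close> is finite.\<close>
  let ?A = "{y. y < x \<and> y \<notin> U}"
  define a where "a = Max ?A"
  define b where "b = (LEAST y. x < y \<and> y \<notin> U)"
  have "?A \<noteq> {}" "finite ?A"
    using assms by (auto intro!: exI[of _ 0] gr0I)
  then have a: "a < x" "a \<notin> U" and a_max: "\<And>y. y < x \<Longrightarrow> y \<notin> U \<Longrightarrow> y \<le> a"
    using Max_in[of ?A] Max_ge[of ?A] unfolding a_def by blast+
  have "x < Suc (Max U) \<and> Suc (Max U) \<notin> U"
    using assms Max_ge[of U] by (metis Suc_n_not_le_n le_imp_less_Suc)
  then have b: "x < b" "b \<notin> U"
    unfolding b_def by (metis (mono_tags, lifting) LeastI)+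
  have b_min: "y \<in> U" if "x < y" "y < b" for y
    using not_less_Least[of y "\<lambda>y. x < y \<and> y \<notin> U"] that unfolding b_def by auto
  have "y \<in> U" if "a < y" "y < b" for y
    using a_max[of y] b_min[of y] that assms(2) by (cases y x rule: linorder_cases) auto
  then have "is_run U (a + 1) (b - (a + 1))"
    using a b unfolding is_run_def by auto
  moreover have "x \<in> {a + 1..<a + 1 + (b - (a + 1))}"
    using a b by auto
  ultimately show thesis ..
qed

lemma is_run_separated:
  assumes "is_run U s k" "A \<subseteq> {s..<s + k}"
  shows "separated A (U - {s..<s + k})"
  unfolding separated_def
proof (intro ballI)
  fix a b
  assume ab: "a \<in> A" "b \<in> U - {s..<s + k}"
  then have "s \<le> a" "a < s + k" "b < s \<or> s + k \<le> b" "b \<noteq> s - 1" "b \<noteq> s + k"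
    using assms unfolding is_run_def by auto
  then show "Suc a < b \<or> Suc b < a"
    by linarith
qed

lemma weight_run:
  assumes "finite U" "is_run U s k"
  shows "weight U = run_weight k + weight (U - {s..<s + k})"
proof -
  have "U = {s..<s + k} \<union> (U - {s..<s + k})"
    using assms(2) by (auto simp: is_run_def)
  then have "weight U = weight {s..<s + k} + weight (U - {s..<s + k})"
    using weight_Un[of "{s..<s + k}" "U - {s..<s + k}"] is_run_separated[OF assms(2) order_refl] assms(1) by simp
  then show ?thesis
    using assms(2) by (simp add: weight_interval is_run_def)
qed

text \<open>The labels bordering the second run cannot belong to the deleted run, because the latter
  is separated from the rest; hence they are missing from \<open>U\<close> itself.\<close>

lemma is_run_Diff:
  assumes "is_run U s k" "is_run (U - {s..<s + k}) s' k'"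
  shows "is_run U s' k'"
proof -
  have sep: "separated {s..<s + k} (U - {s..<s + k})"
    using is_run_separated[OF assms(1) order_refl] .
  have s': "0 < s'" "0 < k'" "{s'..<s' + k'} \<subseteq> U - {s..<s + k}"
    "s' - 1 \<notin> U - {s..<s + k}" "s' + k' \<notin> U - {s..<s + k}"
    using assms(2) unfolding is_run_def by blast+
  then have "s' \<in> U - {s..<s + k}" "s' + k' - 1 \<in> U - {s..<s + k}"
    by (auto intro!: subsetD[OF s'(3)] simp del: Diff_iff)
  moreover have "\<not> (Suc (s' - 1) < s' \<or> Suc s' < s' - 1)"
    "\<not> (Suc (s' + k') < s' + k' - 1 \<or> Suc (s' + k' - 1) < s' + k')"
    using s'(1,2) by linarith+
  ultimately have "s' - 1 \<notin> {s..<s + k}" "s' + k' \<notin> {s..<s + k}"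
    using sep unfolding separated_def by blast+
  then show ?thesis
    using s' unfolding is_run_def by blast
qed

text \<open>Only lengths 2 modulo 4 have odd weight, so runs of other lengths can be stripped off
  without changing the parity.\<close>

lemma odd_weight_run:
  assumes "finite U" "0 \<notin> U" "odd (weight U)"
  shows "\<exists>s k. is_run U s k \<and> k mod 4 = 2"
  using assms
proof (induction "card U" arbitrary: U rule: less_induct)
  case less
  then have "U \<noteq> {}"
    by (auto simp: weight_def)
  then obtain s k where run: "is_run U s k"
    using is_run_exists[OF less.prems(1) _ less.prems(2)] by blast
  let ?V = "U - {s..<s + k}"
  show ?case
  proof (cases "k mod 4 = 2")
    case False
    then have "even (run_weight k)"
      unfolding run_weight_def by presburger
    then have "odd (weight ?V)"
      using weight_run[OF less.prems(1) run] less.prems(3) by simp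
    moreover have "s \<in> U" "s \<notin> ?V"
      using run by (auto simp: is_run_def)
    then have "card ?V < card U"
      using less.prems(1) by (intro psubset_card_mono) blast+
    ultimately show ?thesis
      using less.hyps[of ?V] less.prems is_run_Diff[OF run] by blast
  qed (use run in blast)
qed

text \<open>Covers every kind of move: a prefix of length a and a suffix of length b survive, either
  possibly empty, and \<open>a + b < k\<close> keeps them separated. The additive form avoids
  truncated subtraction.\<close>

lemma weight_replace_run:
  assumes "finite U" "is_run U s k" "U \<inter> near i \<subseteq> {s..<s + k}"
    and "{s..<s + k} - near i = {s..<s + a} \<union> {s + k - b..<s + k}" "a + b < k"
  shows "weight (U - near i) + run_weight k = weight U + run_weight a + run_weight b"
proof -
  let ?I = "{s..<s + a}" and ?J = "{s + k - b..<s + k}"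
  have "U - near i = (?I \<union> ?J) \<union> (U - {s..<s + k})"
    unfolding assms(4)[symmetric] using assms(2,3) by (auto simp: is_run_def)
  moreover have "separated (?I \<union> ?J) (U - {s..<s + k})"
    using assms(2,5) by (intro is_run_separated) auto
  moreover have "separated ?I ?J"
    using assms(4,5) by (auto simp: separated_def)
  moreover have "weight ?I = run_weight a" "weight ?J = run_weight b"
    using assms(2,5) weight_interval[of s a] weight_interval[of "s + k - b" b]
    by (auto simp: is_run_def)
  ultimately show ?thesis
    using weight_run[OF assms(1,2)] assms(1) by (simp add: weight_Un)
qed

section \<open>The game on integers\<close>

definition has_3_run :: "nat set \<Rightarrow> bool" where
  "has_3_run U \<longleftrightarrow> (\<exists>s k. is_run U s k \<and> k mod 4 = 3)"

definition staller_bound :: "nat set \<Rightarrow> nat" where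
  "staller_bound U = (weight U + 1) div 2"

text \<open>These are the values of 1 plus \<open>staller_bound\<close> after Dominator's move: a
  drop of 4 gives (W - 1) div 2; a drop of 3, or of 2 with W even, gives W div 2.\<close>

definition dominator_bound :: "nat set \<Rightarrow> nat" where
  "dominator_bound U = (if has_3_run U then (weight U - 1) div 2 else weight U div 2)"

lemma no_single_gapD: "no_single_gap U \<Longrightarrow> i \<in> U \<Longrightarrow> i + 2 \<in> U \<Longrightarrow> i + 1 \<in> U"
  unfolding no_single_gap_def by blast

text \<open>An interval \<open>near i\<close> has at least two elements, so it cannot contain j + 1
  while avoiding both j and j + 2.\<close>

lemma no_single_gap_Diff:
  assumes "no_single_gap U"
  shows "no_single_gap (U - near i)"
proof -
  have "j + 1 \<in> U - near i" if "j \<in> U - near i" "j + 2 \<in> U - near i" for j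
  proof -
    have "j + 1 \<in> U"
      using assms that unfolding no_single_gap_def by blast
    moreover have "j + 1 \<notin> near i"
      using that by simp linarith
    ultimately show ?thesis ..
  qed
  then show ?thesis
    unfolding no_single_gap_def by blast
qed

text \<open>Two labels hit by one move differ by at most 2, and if they differ by 2 the label
  between them is present too. Hence a move meets a single run.\<close>

lemma near_subset_run:
  assumes "no_single_gap U" "is_run U s k" "x \<in> {s..<s + k}" "x \<in> near i"
  shows "U \<inter> near i \<subseteq> {s..<s + k}"
proof
  fix y
  assume y: "y \<in> U \<inter> near i"
  have outside: "s - 1 \<notin> U" "s + k \<notin> U" and s: "0 < s" "s \<le> x" "x < s + k" "x \<in> U" "y \<in> U"
    using assms(2,3) y by (auto simp: is_run_def)
  have ne: "y \<noteq> s - 1" "y \<noteq> s + k"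
    using outside s(5) by blast+
  have "x \<le> y + 2" "y \<le> x + 2"
    using y assms(4) by auto
  then consider "y = x \<or> y = x + 1 \<or> x = y + 1" | "y = x + 2" | "x = y + 2"
    by linarith
  then show "y \<in> {s..<s + k}"
  proof cases
    case 1
    then show ?thesis
      using s ne by auto
  next
    case 2
    then have "x + 1 \<in> U"
      using no_single_gapD[OF assms(1) s(4)] s(5) by blast
    then have "x + 1 \<noteq> s + k"
      using outside(2) by metis
    then show ?thesis
      using 2 s ne by auto
  next
    case 3
    then have "y + 1 \<in> U"
      using no_single_gapD[OF assms(1) s(5)] s(4) by blast
    then have "y + 1 \<noteq> s - 1"
      using outside(1) by metis
    then show ?thesis
      using 3 s ne by auto
  qed
qed

lemma staller_bound_decrease:
  assumes "finite U" "0 \<notin> U" "no_single_gap U" "U \<inter> near i \<noteq> {}"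
  shows "dominator_bound (U - near i) + 1 \<le> staller_bound U"
proof -
  let ?U = "U - near i"
  obtain x where x: "x \<in> U" "x \<in> near i"
    using assms(4) by blast
  obtain s k where run: "is_run U s k" "x \<in> {s..<s + k}"
    using is_run_exists[OF assms(1) x(1) assms(2)] .
  have sub: "U \<inter> near i \<subseteq> {s..<s + k}"
    using near_subset_run[OF assms(3) run x(2)] .
  have k: "0 < k" "0 < s" "s - 1 \<notin> U" "s + k \<notin> U" "{s..<s + k} \<subseteq> U"
    using run(1) by (auto simp: is_run_def)
  note replace = weight_replace_run[OF assms(1) run(1) sub]
  \<comment> \<open>Either alternative pays for Staller's move: a drop of 1 against the bound W div
    2, or a run of length 3 modulo 4 against (W - 1) div 2.\<close>
  have "weight ?U + 1 \<le> weight U \<or> weight ?U \<le> weight U \<and> has_3_run ?U"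
  proof -
    \<comment> \<open>The move is just outside an end of the run, on an end, or strictly inside. A
      run of length 1 falls under \<open>i = s\<close>, hence the condition \<open>2 \<le> k\<close>
      for the last label.\<close>
    consider "i + 1 = s" | "i = s + k" | "i = s" | "i = s + k - 1" "2 \<le> k" | "s < i" "i + 1 < s + k"
      using run(2) x(2) by force
    then show ?thesis
    proof cases
      case 1
      then have eq: "{s..<s + k} - near i = {s..<s + 0} \<union> {s + k - (k - 1)..<s + k}"
        using k by auto
      then have "weight ?U + run_weight k = weight U + run_weight (k - 1)"
        using replace[OF eq] k(1) by simp
      moreover have "is_run ?U (s + 1) (k - 1)" if "(k - 1) mod 4 = 3"
        using 1 k that subsetD[OF k(5)] by (auto simp: is_run_def intro: gr0I)
      ultimately show ?thesis
        using run_weight_minus_1[OF k(1)] by (auto simp: has_3_run_def)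
    next
      case 2
      then have eq: "{s..<s + k} - near i = {s..<s + (k - 1)} \<union> {s + k - 0..<s + k}"
        using k by auto
      then have "weight ?U + run_weight k = weight U + run_weight (k - 1)"
        using replace[OF eq] k(1) by simp
      moreover have "is_run ?U s (k - 1)" if "(k - 1) mod 4 = 3"
        using 2 k that subsetD[OF k(5)] by (auto simp: is_run_def intro: gr0I)
      ultimately show ?thesis
        using run_weight_minus_1[OF k(1)] by (auto simp: has_3_run_def)
    next
      case 3
      then have eq: "{s..<s + k} - near i = {s..<s + 0} \<union> {s + k - (k - 2)..<s + k}"
        using k by auto
      then have "weight ?U + run_weight k = weight U + run_weight (k - 2)"
        using replace[OF eq] k(1) by simp
      then show ?thesis
        using run_weight_minus_2[OF k(1)] by linarith
    next
      case 4
      then have eq: "{s..<s + k} - near i = {s..<s + (k - 2)} \<union> {s + k - 0..<s + k}"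
        using k by auto
      then have "weight ?U + run_weight k = weight U + run_weight (k - 2)"
        using replace[OF eq] k(1) by simp
      then show ?thesis
        using run_weight_minus_2[OF k(1)] by linarith
    next
      case 5
      define a b where "a = i - 1 - s" and "b = s + k - i - 2"
      have ab: "k = a + b + 3" "i = s + a + 1"
        using 5 by (auto simp: a_def b_def)
      then have eq: "{s..<s + k} - near i = {s..<s + a} \<union> {s + k - b..<s + k}"
        by auto
      then have "weight ?U + run_weight k = weight U + run_weight a + run_weight b"
        using replace[OF eq] ab(1) by simp
      then show ?thesis
        using run_weight_split[of a b] ab by simp
    qed
  qed
  \<comment> \<open>Positivity is needed so that \<open>weight ?U - 1\<close> in
    \<open>dominator_bound\<close> does not truncate.\<close>
  moreover have "4 \<le> weight ?U" if has: "has_3_run ?U"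
  proof -
    obtain s' k' where r: "is_run ?U s' k'" "k' mod 4 = 3"
      using has unfolding has_3_run_def by blast
    then have "4 \<le> run_weight k'"
      by (simp add: run_weight_def)
    then show ?thesis
      using weight_run[OF _ r(1)] assms(1) by simp
  qed
  ultimately show ?thesis
    unfolding dominator_bound_def staller_bound_def by auto
qed

text \<open>The interval \<open>near (s + j - 2)\<close> ends at s + j - 1, the j-th label of the
  run, and begins at or below s because j is at most 3. It cuts off exactly the first j
  labels.\<close>

lemma weight_remove_prefix:
  assumes "finite U" "no_single_gap U" "is_run U s k" "0 < j" "j \<le> 3" "j \<le> k"
  shows "weight (U - near (s + j - 2)) + run_weight k = weight U + run_weight (k - j)"
proof -
  have s: "0 < s"
    using assms(3) by (simp add: is_run_def)
  have "U \<inter> near (s + j - 2) \<subseteq> {s..<s + k}"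
    by (rule near_subset_run[OF assms(2,3), of s]) (use assms s in auto)
  moreover have "{s..<s + k} - near (s + j - 2) = {s..<s + 0} \<union> {s + k - (k - j)..<s + k}"
    using assms s by auto
  ultimately show ?thesis
    using weight_replace_run[OF assms(1,3), of "s + j - 2" 0 "k - j"] assms(4,6) by simp
qed

text \<open>Dominator cuts a prefix of 3, 2, 1 or 3 labels from a run of length 3, 2, 1 or 0 modulo
  4, in this order of preference for 3 and then 2. The first conclusion serves to find a vertex
  labelled i: cutting one label means playing at s - 1, just below the run.\<close>

lemma dominator_bound_decrease:
  assumes "finite U" "0 \<notin> U" "no_single_gap U" "U \<noteq> {}"
  obtains i where "i \<in> U \<or> Suc i \<in> U" "U \<inter> near i \<noteq> {}"
    "staller_bound (U - near i) + 1 \<le> dominator_bound U"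
proof -
  note witness = that
  have move: thesis
    if run: "is_run U s k" and j: "0 < j" "j \<le> 3" "j \<le> k"
      and less: "\<And>W. W + run_weight k = weight U + run_weight (k - j) \<Longrightarrow>
        (W + 1) div 2 + 1 \<le> dominator_bound U" for s k j
  proof (rule witness[of "s + j - 2"])
    have "0 < s" and sub: "{s..<s + k} \<subseteq> U"
      using run by (auto simp: is_run_def)
    then have "s \<in> U" "s + j - 1 \<in> U"
      using j by (auto intro!: subsetD[OF sub])
    moreover have "Suc (s + j - 2) = s + j - 1"
      using \<open>0 < s\<close> j by linarith
    ultimately show "s + j - 2 \<in> U \<or> Suc (s + j - 2) \<in> U"
      by simp
    have "s \<in> near (s + j - 2)"
      using j by auto
    then show "U \<inter> near (s + j - 2) \<noteq> {}"
      using \<open>s \<in> U\<close> by blast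
    show "staller_bound (U - near (s + j - 2)) + 1 \<le> dominator_bound U"
      unfolding staller_bound_def
      by (rule less) (rule weight_remove_prefix[OF assms(1,3) run j])
  qed
  have le: "run_weight k \<le> weight U" if "is_run U s k" for s k
    using weight_run[OF assms(1) that] by simp
  show thesis
  proof (cases "has_3_run U")
    case True
    then obtain s k where run: "is_run U s k" "k mod 4 = 3"
      unfolding has_3_run_def by blast
    from run(2) have "run_weight k = run_weight (k - 3) + 4" "3 \<le> k"
      using run_weight_minus_mod_4[of k] mod_less_eq_dividend[of k 4] by simp_all
    then show thesis
      using True le[OF run(1)] by (intro move[OF run(1), of 3]) (auto simp: dominator_bound_def)
  next
    case no3: False
    show thesis
    proof (cases "\<exists>s k. is_run U s k \<and> k mod 4 = 2")
      case True
      then obtain s k where run: "is_run U s k" "k mod 4 = 2"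
        by auto
      from run(2) have "run_weight k = run_weight (k - 2) + 3" "2 \<le> k"
        using run_weight_minus_mod_4[of k] mod_less_eq_dividend[of k 4] by simp_all
      then show thesis
        using no3 le[OF run(1)] by (intro move[OF run(1), of 2]) (auto simp: dominator_bound_def)
    next
      case no2: False
      \<comment> \<open>For odd W a drop of 2 would fall short by one after rounding.\<close>
      then have even: "even (weight U)"
        using odd_weight_run[OF assms(1,2)] by blast
      obtain s k where run: "is_run U s k"
        using is_run_exists[OF assms(1) _ assms(2)] assms(4) by blast
      show thesis
      proof (cases "k mod 4 = 1")
        case True
        then have "run_weight k = run_weight (k - 1) + 2" "1 \<le> k"
          using run_weight_minus_mod_4[of k] mod_less_eq_dividend[of k 4] by simp_all
        then show thesis
          using no3 le[OF run] even
          by (intro move[OF run, of 1]) (simp_all add: dominator_bound_def, presburger)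
      next
        case False
        moreover have "k mod 4 \<noteq> 2" "k mod 4 \<noteq> 3"
          using run no3 no2 unfolding has_3_run_def by blast+
        moreover have "0 < k"
          using run by (simp add: is_run_def)
        ultimately have "k mod 4 = 0" "0 < k"
          by presburger+
        then have "run_weight k = run_weight (k - 3) + 2" "3 \<le> k"
          using run_weight_minus_3[of k] by simp_all
        then show thesis
          using no3 le[OF run] even
          by (intro move[OF run, of 3]) (simp_all add: dominator_bound_def, presburger)
      qed
    qed
  qed
qed

section \<open>From the domination game to a game on integers\<close>

lemma moves_left_Staller_le:
  assumes "\<And>v. v \<in> legal_moves G S \<Longrightarrow> moves_left G Dominator (insert v S) + 1 \<le> B"
  shows "moves_left G Staller S \<le> B"
proof (cases "infinite (pverts G) \<or> legal_moves G S = {}")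
  case True
  then show ?thesis by (subst moves_left.simps) auto
next
  case False
  then have "finite ((\<lambda>v. moves_left G Dominator (insert v S)) ` legal_moves G S)"
    by (simp add: legal_moves_def)
  then have "Max ((\<lambda>v. moves_left G Dominator (insert v S)) ` legal_moves G S) + 1 \<le> B"
    using Max_in[of "(\<lambda>v. moves_left G Dominator (insert v S)) ` legal_moves G S"] False assms
    by fastforce
  then show ?thesis
    using False by (subst moves_left.simps) simp
qed

lemma moves_left_Dominator_le:
  assumes "v \<in> legal_moves G S" "moves_left G Staller (insert v S) + 1 \<le> B"
  shows "moves_left G Dominator S \<le> B"
proof (cases "infinite (pverts G)")
  case True
  then show ?thesis by (subst moves_left.simps) auto
next
  case False
  then have "finite ((\<lambda>v. moves_left G Staller (insert v S)) ` legal_moves G S)"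
    by (simp add: legal_moves_def)
  then have "Min ((\<lambda>v. moves_left G Staller (insert v S)) ` legal_moves G S)
      \<le> moves_left G Staller (insert v S)"
    using assms(1) by (intro Min_le) auto
  then show ?thesis
    using False assms by (subst moves_left.simps) auto
qed

text \<open>
  Once \<open>c\<close> has been selected, the rest of the game is a game on a line: the undominated vertices
  are labelled by integers, and selecting a vertex labelled \<open>i\<close> dominates the labels in \<open>near i\<close>.
\<close>

locale line_labelling =
  fixes G :: "'a pair_pre_digraph" and c :: 'a and f :: "'a \<Rightarrow> nat"
  assumes finite_verts: "finite (pverts G)"
    and inj: "inj_on f (pverts G - closed_nbhd G c)"
    and pos: "u \<in> pverts G - closed_nbhd G c \<Longrightarrow> 0 < f u"
    and nbhd: "u \<in> pverts G - closed_nbhd G c \<Longrightarrow> v \<in> pverts G \<Longrightarrow> v \<noteq> c \<Longrightarrow>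
      u \<in> closed_nbhd G v \<longleftrightarrow> f u \<in> near (f v)"
    and pred: "u \<in> pverts G - closed_nbhd G c \<Longrightarrow> \<exists>v\<in>pverts G. v \<noteq> c \<and> Suc (f v) = f u"
    and gap: "no_single_gap (f ` (pverts G - closed_nbhd G c))"
begin

definition undominated :: "'a set \<Rightarrow> nat set" where
  "undominated S = f ` (pverts G - dominated G S)"

lemma finite_undominated: "finite (undominated S)"
  by (simp add: undominated_def finite_verts)

lemma subset_verts: "c \<in> S \<Longrightarrow> pverts G - dominated G S \<subseteq> pverts G - closed_nbhd G c"
  by (auto simp: dominated_def)

lemma zero_undominated: "c \<in> S \<Longrightarrow> 0 \<notin> undominated S"
  using subset_verts[of S] pos unfolding undominated_def by fastforce

lemma undominated_insert:
  assumes "c \<in> S" "v \<in> pverts G" "v \<noteq> c"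
  shows "undominated (insert v S) = undominated S - near (f v)"
proof -
  have "pverts G - dominated G (insert v S) = {u \<in> pverts G - dominated G S. f u \<notin> near (f v)}"
    using subset_verts[OF assms(1)] nbhd[OF _ assms(2,3)] unfolding dominated_def by blast
  then show ?thesis
    unfolding undominated_def by blast
qed

lemma legal_iff:
  assumes "c \<in> S" "v \<in> pverts G" "v \<noteq> c"
  shows "v \<in> legal_moves G S \<longleftrightarrow> undominated S \<inter> near (f v) \<noteq> {}"
proof -
  have "v \<in> legal_moves G S \<longleftrightarrow> (\<exists>u \<in> pverts G - dominated G S. u \<in> closed_nbhd G v)"
    using assms(2) unfolding legal_moves_def closed_nbhd_def by blast
  also have "\<dots> \<longleftrightarrow> (\<exists>u \<in> pverts G - dominated G S. f u \<in> near (f v))"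
    using subset_verts[OF assms(1)] nbhd[OF _ assms(2,3)] by blast
  finally show ?thesis
    unfolding undominated_def by blast
qed

text \<open>Both bounds go through one induction on the number of undominated labels, since each
  player's bound rests on the opponent's bound after the move.\<close>

lemma moves_left_le:
  assumes "c \<in> S" "no_single_gap (undominated S)"
  shows "moves_left G Staller S \<le> staller_bound (undominated S) \<and>
    moves_left G Dominator S \<le> dominator_bound (undominated S)"
  using assms
proof (induction "card (undominated S)" arbitrary: S rule: less_induct)
  case less
  have zero: "0 \<notin> undominated S"
    by (rule zero_undominated[OF less.prems(1)])
  have IH: "moves_left G Staller (insert v S) \<le> staller_bound (undominated S - near (f v))"
    "moves_left G Dominator (insert v S) \<le> dominator_bound (undominated S - near (f v))"
    if "v \<in> pverts G" "v \<noteq> c" "undominated S \<inter> near (f v) \<noteq> {}" for v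
  proof -
    have eq: "undominated (insert v S) = undominated S - near (f v)"
      using undominated_insert less.prems(1) that by blast
    have "card (undominated S - near (f v)) < card (undominated S)"
      using that by (intro psubset_card_mono finite_undominated) blast
    then show "moves_left G Staller (insert v S) \<le> staller_bound (undominated S - near (f v))"
      "moves_left G Dominator (insert v S) \<le> dominator_bound (undominated S - near (f v))"
      using less.hyps[of "insert v S"] no_single_gap_Diff[OF less.prems(2)] unfolding eq
      by (simp_all add: less.prems(1))
  qed
  have "moves_left G Staller S \<le> staller_bound (undominated S)"
  proof (rule moves_left_Staller_le)
    fix v
    assume v: "v \<in> legal_moves G S"
    have "v \<in> pverts G" "v \<noteq> c"
      using v less.prems(1) unfolding legal_moves_def dominated_def by blast+
    moreover from this have "undominated S \<inter> near (f v) \<noteq> {}"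
      using legal_iff[OF less.prems(1)] v by blast
    ultimately show "moves_left G Dominator (insert v S) + 1 \<le> staller_bound (undominated S)"
      using IH(2) staller_bound_decrease[OF finite_undominated zero less.prems(2)]
      by (meson add_le_mono1 le_trans)
  qed
  moreover have "moves_left G Dominator S \<le> dominator_bound (undominated S)"
  proof (cases "undominated S = {}")
    case True
    then have "legal_moves G S = {}"
      unfolding undominated_def legal_moves_def closed_nbhd_def by blast
    then show ?thesis
      by (subst moves_left.simps) simp
  next
    case False
    then obtain i where i: "i \<in> undominated S \<or> Suc i \<in> undominated S"
      "undominated S \<inter> near i \<noteq> {}"
      "staller_bound (undominated S - near i) + 1 \<le> dominator_bound (undominated S)"
      using dominator_bound_decrease[OF finite_undominated zero less.prems(2)] by metis
    \<comment> \<open>The label to be played either belongs to an undominated vertex or precedes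
      such a label; \<open>pred\<close> supplies a vertex in the second case.\<close>
    have "\<exists>v\<in>pverts G. v \<noteq> c \<and> f v = i"
      using i(1)
    proof
      assume "i \<in> undominated S"
      then obtain u where "u \<in> pverts G - dominated G S" "f u = i"
        unfolding undominated_def by blast
      moreover from this have "u \<noteq> c"
        using less.prems(1) by (auto simp: dominated_def closed_nbhd_def)
      ultimately show ?thesis
        by blast
    next
      assume "Suc i \<in> undominated S"
      then obtain u where "u \<in> pverts G - dominated G S" "f u = Suc i"
        unfolding undominated_def by (metis imageE)
      then show ?thesis
        using pred[of u] subset_verts[OF less.prems(1)] by auto
    qed
    then obtain v where v: "v \<in> pverts G" "v \<noteq> c" "f v = i"
      by blast
    show ?thesis
    proof (rule moves_left_Dominator_le)
      show "v \<in> legal_moves G S"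
        using legal_iff[OF less.prems(1)] v i(2) by blast
      show "moves_left G Staller (insert v S) + 1 \<le> dominator_bound (undominated S)"
        using IH(1)[OF v(1,2)] i(2,3) v(3) by simp
    qed
  qed
  ultimately show ?case ..
qed

text \<open>Dominator opens with \<open>c\<close>, which accounts for the added 1.\<close>

lemma game_domination_number_le:
  assumes "c \<in> pverts G"
  shows "\<gamma>\<^sub>g G \<le> staller_bound (f ` (pverts G - closed_nbhd G c)) + 1"
  unfolding game_domination_number_def
proof (rule moves_left_Dominator_le)
  show "c \<in> legal_moves G {}"
    using assms by (auto simp: legal_moves_def dominated_def closed_nbhd_def)
  have "undominated {c} = f ` (pverts G - closed_nbhd G c)"
    by (simp add: undominated_def dominated_def)
  then show "moves_left G Staller (insert c {}) + 1
      \<le> staller_bound (f ` (pverts G - closed_nbhd G c)) + 1"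
    using moves_left_le[of "{c}"] gap by simp
qed

end

section \<open>Tadpoles\<close>

text \<open>The cycle is numbered from 0 at \<open>c\<close>, the path from m at \<open>e\<close>,
  whichever end that is. The consecutive labels m - 1 and m belong to non-adjacent vertices, but
  both are neighbours of \<open>c\<close> and are dominated by the opening move.\<close>

definition tadpole_label :: "nat \<Rightarrow> nat \<Rightarrow> nat \<Rightarrow> nat \<Rightarrow> nat + nat \<Rightarrow> nat" where
  "tadpole_label m n c e = case_sum
     (\<lambda>x. if c \<le> x then x - c else x + m - c)
     (\<lambda>j. if e = 0 then m + j else m + (n - 1 - j))"

lemma verts_tadpole: "pverts (tadpole m n c e) = Inl ` {..<m} \<union> Inr ` {..<n}"
  by (auto simp: tadpole_def add_edge_def disjoint_union_def cycle_graph_def path_graph_def)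

lemma arcs_tadpole:
  "(Inl x, Inl y) \<in> parcs (tadpole m n c e) \<longleftrightarrow>
     x < m \<and> y < m \<and> (y = Suc x mod m \<or> x = Suc y mod m)"
  "(Inr i, Inr j) \<in> parcs (tadpole m n c e) \<longleftrightarrow> i < n \<and> j < n \<and> (j = Suc i \<or> i = Suc j)"
  "(Inl x, Inr j) \<in> parcs (tadpole m n c e) \<longleftrightarrow> x = c \<and> j = e"
  "(Inr j, Inl x) \<in> parcs (tadpole m n c e) \<longleftrightarrow> x = c \<and> j = e"
  by (auto simp: tadpole_def add_edge_def disjoint_union_def cycle_graph_def path_graph_def)

text \<open>The label is x - c modulo m, a rotation of the cycle, so it respects the cyclic
  successor.\<close>

lemma tadpole_label_Inl:
  assumes "x < m" "c < m"
  shows "tadpole_label m n c e (Inl x) < m"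
    "tadpole_label m n c e (Inl x) = 0 \<longleftrightarrow> x = c"
    "y < m \<Longrightarrow> tadpole_label m n c e (Inl x) = tadpole_label m n c e (Inl y) \<longleftrightarrow> x = y"
    "y < m \<Longrightarrow> y = Suc x mod m \<longleftrightarrow>
      tadpole_label m n c e (Inl y) = Suc (tadpole_label m n c e (Inl x)) mod m"
proof -
  show "tadpole_label m n c e (Inl x) < m"
    "tadpole_label m n c e (Inl x) = 0 \<longleftrightarrow> x = c"
    "y < m \<Longrightarrow> tadpole_label m n c e (Inl x) = tadpole_label m n c e (Inl y) \<longleftrightarrow> x = y"
    using assms by (auto simp: tadpole_label_def)
  have Suc_mod: "Suc i mod m = (if Suc i = m then 0 else Suc i)" if "i < m" for i
    using that by (simp add: mod_Suc)
  show "y = Suc x mod m \<longleftrightarrow>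
      tadpole_label m n c e (Inl y) = Suc (tadpole_label m n c e (Inl x)) mod m" if "y < m"
    using assms that \<open>tadpole_label m n c e (Inl x) < m\<close>
    by (auto simp: Suc_mod tadpole_label_def split: if_splits)
qed

text \<open>The label is a shift of the path if e is 0 and a shifted reflection otherwise.\<close>

lemma tadpole_label_Inr:
  assumes "j < n" "e \<in> path_ends n"
  shows "m \<le> tadpole_label m n c e (Inr j)" "tadpole_label m n c e (Inr j) < m + n"
    "tadpole_label m n c e (Inr j) = m \<longleftrightarrow> j = e"
    "i < n \<Longrightarrow> tadpole_label m n c e (Inr i) = tadpole_label m n c e (Inr j) \<longleftrightarrow> i = j"
    "i < n \<Longrightarrow> i = Suc j \<or> j = Suc i \<longleftrightarrow>
      tadpole_label m n c e (Inr i) = Suc (tadpole_label m n c e (Inr j)) \<or>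
      tadpole_label m n c e (Inr j) = Suc (tadpole_label m n c e (Inr i))"
  using assms by (auto simp: tadpole_label_def path_ends_def)

context
  fixes m n c e :: nat
  assumes m: "3 \<le> m" and n: "1 \<le> n" and c: "c < m" and e: "e \<in> path_ends n"
begin

abbreviation (input) T :: "(nat + nat) pair_pre_digraph" where
  "T \<equiv> tadpole m n c e"

abbreviation (input) L :: "nat + nat \<Rightarrow> nat" where
  "L \<equiv> tadpole_label m n c e"

lemma bij_betw_tadpole_label: "bij_betw L (pverts T) {..<m + n}"
proof -
  have "inj_on L (pverts T)"
  proof (rule inj_onI)
    fix u v
    assume uv: "u \<in> pverts T" "v \<in> pverts T" "L u = L v"
    have Inl: "L (Inl x) < m" if "x < m" for x
      using tadpole_label_Inl(1)[OF that c] .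
    have Inr: "m \<le> L (Inr j)" if "j < n" for j
      using tadpole_label_Inr(1)[OF that e] .
    show "u = v"
    proof (cases u; cases v)
      fix x y
      assume "u = Inl x" "v = Inl y"
      then show ?thesis
        using uv tadpole_label_Inl(3)[OF _ c, of x y n e] by (auto simp: verts_tadpole)
    next
      fix x j
      assume "u = Inl x" "v = Inr j"
      then show ?thesis
        using uv Inl[of x] Inr[of j] by (auto simp: verts_tadpole)
    next
      fix x j
      assume "u = Inr j" "v = Inl x"
      then show ?thesis
        using uv Inl[of x] Inr[of j] by (auto simp: verts_tadpole)
    next
      fix i j
      assume "u = Inr i" "v = Inr j"
      then show ?thesis
        using uv tadpole_label_Inr(4)[OF _ e, of j i m c] by (auto simp: verts_tadpole)
    qed
  qed
  moreover have "L ` pverts T \<subseteq> {..<m + n}"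
    unfolding verts_tadpole
    using tadpole_label_Inl(1)[OF _ c, of _ n e] tadpole_label_Inr(2)[OF _ e, of _ m c]
    by (fastforce intro: trans_less_add1)
  \<comment> \<open>Equal cardinality turns the inclusion of the image into equality.\<close>
  moreover have "card (pverts T) = m + n"
    unfolding verts_tadpole by (subst card_Un_disjoint) (auto simp: card_image)
  ultimately show ?thesis
    unfolding bij_betw_def by (metis card_image card_lessThan card_subset_eq finite_lessThan)
qed

text \<open>The alternatives are equality, a cycle edge, a path edge and the joining edge, whose
  ends have labels 0 and m. Comparison with m tells cycle from path.\<close>

lemma closed_nbhd_tadpole:
  assumes "u \<in> pverts T" "v \<in> pverts T"
  shows "u \<in> closed_nbhd T v \<longleftrightarrow> L u = L v \<or>
    L u < m \<and> L v < m \<and> (L u = Suc (L v) mod m \<or> L v = Suc (L u) mod m) \<or>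
    m \<le> L u \<and> m \<le> L v \<and> (L u = Suc (L v) \<or> L v = Suc (L u)) \<or>
    L u = 0 \<and> L v = m \<or> L u = m \<and> L v = 0"
proof -
  have eq: "u = v \<longleftrightarrow> L u = L v"
    using assms bij_betw_tadpole_label by (auto simp: bij_betw_def inj_on_def)
  have Inl: "L (Inl x) < m" "\<not> m \<le> L (Inl x)" "L (Inl x) \<noteq> m" "L (Inl x) = 0 \<longleftrightarrow> x = c"
    if "x < m" for x
    using tadpole_label_Inl(1,2)[OF that c, of n e] by auto
  have Inr: "\<not> L (Inr j) < m" "m \<le> L (Inr j)" "L (Inr j) \<noteq> 0" "L (Inr j) = m \<longleftrightarrow> j = e" if "j < n" for j
    using tadpole_label_Inr[OF that e, of m c] m by auto
  show ?thesis
  proof (cases u)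
    case u: (Inl x)
    show ?thesis
    proof (cases v)
      case v: (Inl y)
      have "x < m" "y < m"
        using assms u v by (auto simp: verts_tadpole)
      then show ?thesis
        using Inl[of x] Inl[of y] assms(1) eq tadpole_label_Inl(4)[OF \<open>x < m\<close> c \<open>y < m\<close>, of n e]
          tadpole_label_Inl(4)[OF \<open>y < m\<close> c \<open>x < m\<close>, of n e]
        unfolding closed_nbhd_def u v by (auto simp: arcs_tadpole)
    next
      case v: (Inr j)
      have "x < m" "j < n"
        using assms u v by (auto simp: verts_tadpole)
      then show ?thesis
        using Inl[of x] Inr[of j] assms(1)
        unfolding closed_nbhd_def u v by (auto simp: arcs_tadpole)
    qed
  next
    case u: (Inr i)
    show ?thesis
    proof (cases v)
      case v: (Inl y)
      have "y < m" "i < n"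
        using assms u v by (auto simp: verts_tadpole)
      then show ?thesis
        using Inl[of y] Inr[of i] assms(1)
        unfolding closed_nbhd_def u v by (auto simp: arcs_tadpole)
    next
      case v: (Inr j)
      have "i < n" "j < n"
        using assms u v by (auto simp: verts_tadpole)
      then show ?thesis
        using Inr[of i] Inr[of j] assms(1) eq tadpole_label_Inr(5)[OF \<open>j < n\<close> e \<open>i < n\<close>, of m c]
        unfolding closed_nbhd_def u v by (auto simp: arcs_tadpole)
    qed
  qed
qed

lemma tadpole_label_joint: "Inl c \<in> pverts T" "L (Inl c) = 0" "v \<in> pverts T \<Longrightarrow> v \<noteq> Inl c \<Longrightarrow> 0 < L v"
proof -
  show c': "Inl c \<in> pverts T" "L (Inl c) = 0"
    using c by (auto simp: verts_tadpole tadpole_label_def)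
  show "v \<in> pverts T \<Longrightarrow> v \<noteq> Inl c \<Longrightarrow> 0 < L v"
    using c' bij_betw_tadpole_label unfolding bij_betw_def inj_on_def by (metis gr0I)
qed

lemma outside_nbhd_c:
  "u \<in> pverts T - closed_nbhd T (Inl c) \<longleftrightarrow>
    u \<in> pverts T \<and> L u \<noteq> 0 \<and> L u \<noteq> 1 \<and> L u \<noteq> m - 1 \<and> L u \<noteq> m"
proof (cases "u \<in> pverts T")
  case True
  have "0 = Suc (L u) mod m \<longleftrightarrow> L u = m - 1" if "L u < m"
    using that by (auto simp: mod_Suc)
  moreover have "Suc 0 mod m = 1"
    using m by simp
  ultimately have "u \<in> closed_nbhd T (Inl c) \<longleftrightarrow> L u = 0 \<or> L u = 1 \<or> L u = m - 1 \<or> L u = m"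
    using m unfolding closed_nbhd_tadpole[OF True tadpole_label_joint(1)] tadpole_label_joint(2)
    by (cases "L u < m") auto
  then show ?thesis
    using True by simp
qed auto

text \<open>The opening move removes 0, 1, m - 1 and m. The intervals are written with explicit
  lengths to fit \<open>weight_interval\<close>.\<close>

lemma label_outside_nbhd_c:
  "L ` (pverts T - closed_nbhd T (Inl c)) = {2..<2 + (m - 3)} \<union> {m + 1..<m + 1 + (n - 1)}"
proof -
  have "L ` (pverts T - closed_nbhd T (Inl c)) = {l \<in> L ` pverts T. l \<noteq> 0 \<and> l \<noteq> 1 \<and> l \<noteq> m - 1 \<and> l \<noteq> m}"
    using outside_nbhd_c by (auto simp del: Diff_iff)
  also have "L ` pverts T = {..<m + n}"
    using bij_betw_tadpole_label by (simp add: bij_betw_def)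
  also have "{l \<in> {..<m + n}. l \<noteq> 0 \<and> l \<noteq> 1 \<and> l \<noteq> m - 1 \<and> l \<noteq> m} =
      {2..<2 + (m - 3)} \<union> {m + 1..<m + 1 + (n - 1)}"
  proof (intro set_eqI iffI)
    fix l
    assume "l \<in> {l \<in> {..<m + n}. l \<noteq> 0 \<and> l \<noteq> 1 \<and> l \<noteq> m - 1 \<and> l \<noteq> m}"
    then have "2 \<le> l \<and> l < 2 + (m - 3) \<or> m + 1 \<le> l \<and> l < m + 1 + (n - 1)"
      using m n unfolding mem_Collect_eq lessThan_iff by linarith
    then show "l \<in> {2..<2 + (m - 3)} \<union> {m + 1..<m + 1 + (n - 1)}"
      by simp
  next
    fix l
    assume "l \<in> {2..<2 + (m - 3)} \<union> {m + 1..<m + 1 + (n - 1)}"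
    then have "2 \<le> l \<and> l < 2 + (m - 3) \<or> m + 1 \<le> l \<and> l < m + 1 + (n - 1)"
      by simp
    then have "l < m + n \<and> l \<noteq> 0 \<and> l \<noteq> 1 \<and> l \<noteq> m - 1 \<and> l \<noteq> m"
      using m n by linarith
    then show "l \<in> {l \<in> {..<m + n}. l \<noteq> 0 \<and> l \<noteq> 1 \<and> l \<noteq> m - 1 \<and> l \<noteq> m}"
      by simp
  qed
  finally show ?thesis .
qed

lemma line_labelling_tadpole: "line_labelling T (Inl c) L"
proof
  show "finite (pverts T)"
    by (simp add: verts_tadpole)
  show "inj_on L (pverts T - closed_nbhd T (Inl c))"
    using bij_betw_tadpole_label by (auto simp: bij_betw_def inj_on_def)
  \<comment> \<open>Both m - 1 and m are missing between the two intervals, so the gap has length at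
    least 2.\<close>
  show "no_single_gap (L ` (pverts T - closed_nbhd T (Inl c)))"
    using m unfolding label_outside_nbhd_c no_single_gap_def by auto
next
  fix u
  assume u: "u \<in> pverts T - closed_nbhd T (Inl c)"
  then have Lu: "u \<in> pverts T" "L u \<noteq> 0" "L u \<noteq> 1" "L u \<noteq> m - 1" "L u \<noteq> m"
    using outside_nbhd_c by blast+
  then show "0 < L u"
    by simp
  have "L u \<in> {..<m + n}"
    using Lu(1) bij_betwE[OF bij_betw_tadpole_label] by blast
  then have "L u - 1 \<in> L ` pverts T"
    using bij_betw_tadpole_label by (auto simp: bij_betw_def)
  then obtain v where v: "v \<in> pverts T" "L v = L u - 1"
    by (metis imageE)
  moreover have "v \<noteq> Inl c"
    using v Lu tadpole_label_joint(2) by auto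
  ultimately show "\<exists>v\<in>pverts T. v \<noteq> Inl c \<and> Suc (L v) = L u"
    using Lu by force
  fix v
  assume v: "v \<in> pverts T" "v \<noteq> Inl c"
  then have "0 < L v"
    using tadpole_label_joint(3) by blast
  \<comment> \<open>The cyclic successor wraps around only to label 0, which neither u nor v
    carries.\<close>
  have succ: "L u = Suc (L v) mod m \<longleftrightarrow> L u = Suc (L v)" if "L v < m"
    using Lu that by (auto simp: mod_Suc)
  have pred: "L v = Suc (L u) mod m \<longleftrightarrow> L v = Suc (L u)" if "L u < m"
    using Lu that \<open>0 < L v\<close> by (auto simp: mod_Suc)
  \<comment> \<open>Consecutive labels on different sides must be m - 1 and m, and u carries
    neither.\<close>
  have same_side: "L u < m \<longleftrightarrow> L v < m" if "L u = Suc (L v) \<or> L v = Suc (L u)"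
    using that Lu(4,5) by (elim disjE) auto
  have "L u \<in> near (L v) \<longleftrightarrow> L u = L v \<or> L u = Suc (L v) \<or> L v = Suc (L u)"
    by (simp only: atLeastAtMost_iff) linarith
  then show "u \<in> closed_nbhd T v \<longleftrightarrow> L u \<in> near (L v)"
    unfolding closed_nbhd_tadpole[OF Lu(1) v(1)] not_less[symmetric]
    using succ pred same_side Lu(2,5) by blast
qed

lemma weight_tadpole: "weight (L ` (pverts T - closed_nbhd T (Inl c))) \<le> m + n - 2"
proof -
  have "separated {2..<2 + (m - 3)} {m + 1..<m + 1 + (n - 1)}"
    by (auto simp: separated_def)
  then have "weight (L ` (pverts T - closed_nbhd T (Inl c))) = run_weight (m - 3) + run_weight (n - 1)"
    unfolding label_outside_nbhd_c by (simp only: weight_Un weight_interval finite_atLeastLessThan)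
  then show ?thesis
    using run_weight_le[of "m - 3"] run_weight_le[of "n - 1"] m n by linarith
qed

end

theorem theorem4p1:
  fixes m n c e :: nat
  assumes "m \<ge> 3" and "n \<ge> 1"
    and "c \<in> pverts (cycle_graph m)" and "e \<in> path_ends n"
  shows "int (\<gamma>\<^sub>g (tadpole m n c e)) \<le> \<lceil>real (m + n) / 2\<rceil>"
proof -
  have c: "c < m"
    using assms(3) by (simp add: cycle_graph_def)
  \<comment> \<open>The opening move plus \<open>staller_bound\<close> at weight m + n - 2.\<close>
  have "\<gamma>\<^sub>g (tadpole m n c e) \<le> (m + n - 1) div 2 + 1"
    using line_labelling.game_domination_number_le[OF line_labelling_tadpole tadpole_label_joint(1)]
      weight_tadpole assms c by (fastforce simp: staller_bound_def)
  then have "2 * \<gamma>\<^sub>g (tadpole m n c e) \<le> m + n + 1"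
    using assms(1) by linarith
  then have "2 * real (\<gamma>\<^sub>g (tadpole m n c e)) \<le> real m + real n + 1"
    by linarith
  \<comment> \<open>An integer k is at most the ceiling of x iff k - 1 < x, so the surplus 1 in the
    doubled inequality is harmless.\<close>
  then show ?thesis
    unfolding le_ceiling_iff by simp
qed

end
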